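(* Let $K\subset\mathbb{E}$ be a proper cone and let $F:\operatorname{int}K\to\mathbb{R}$ be a logarithmically homogeneous self-concordant barrier for $K$ with parameter $\nu$. Then for all $x\in\operatorname{int}K$ and $s\in\operatorname{int}K^*$, $$\nu\ln\frac{\nu}{\langle s,x\rangle}\;\le\;F(x)+F_*(s)+\nu\;\le\;\nu\ln\frac{\langle\nabla F(x),\nabla F_*(s)\rangle}{\nu},$$ where equality in both sides is achieved only for $s=-\mu\nabla F(x)$ with some $\mu>0$.
   Context: $\mathbb{E}$ is a finite-dimensional real vector space, $\mathbb{E}^*$ its dual space, and $\langle s,x\rangle$ is the value of $s\in\mathbb{E}^*$ at $x\in\mathbb{E}$. For a smooth function $f$, $\nabla f(x)\in\mathbb{E}^*$ and $\nabla^2f(x):\mathbb{E}\to\mathbb{E}^*$ are the gradient and the Hessian, and $D^kf(x)[h]^k$ is the $k$th directional derivative along $h$. A closed convex function $f$, three times continuously differentiable on its open domain, is self-concordant if $D^3f(x)[h]^3\le 2\,(D^2f(x)[h]^2)^{3/2}$ for all $x\in\operatorname{dom}f$, $h\in\mathbb{E}$. A self-concordant function $F$ is a self-concordant barrier with parameter $\nu\ge1$ if $\langle\nabla F(x),h\rangle^2\le\nu\langle\nabla^2F(x)h,h\rangle$ for all $x\in\operatorname{dom}F$, $h\in\mathbb{E}$. A cone $K$ is proper if it is closed, convex and pointed (contains no straight lines); here it has nonempty interior. A barrier $F$ for $K$ has domain $\operatorname{int}K$. It is logarithmically homogeneous if $F(\tau x)=F(x)-\nu\ln\tau$ for all $x\in\operatorname{int}K$,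 $\tau>0$, with $\nu$ the parameter of the barrier. The dual cone is $K^*=\{s\in\mathbb{E}^*:\langle s,x\rangle\ge0\ \forall x\in K\}$, and the dual barrier is $F_*(s)=\max_{x\in\operatorname{int}K}[-\langle s,x\rangle-F(x)]$ for $s\in\operatorname{int}K^*$; $\nabla F_*(s)\in\mathbb{E}$. *)

theory Defs
  imports "HOL-Analysis.Analysis"
begin

text \<open>
  The primal space is a type \<open>'a::euclidean_space\<close>; its inner product is never used. The dual
  space is the type \<open>'a \<Rightarrow>\<^sub>L real\<close>, and the pairing of \<open>s\<close> with \<open>x\<close> is the application \<open>s x\<close>
  (\<open>blinfun_apply\<close> is a coercion). A function with open domain \<open>D\<close> is a total function together
  with the set \<open>D\<close>; its values outside \<open>D\<close> play no role.
\<close>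

definition grad :: "('a::real_normed_vector \<Rightarrow> 'b::real_normed_vector) \<Rightarrow> 'a \<Rightarrow> 'a \<Rightarrow>\<^sub>L 'b" where
  "grad f x = Blinfun (frechet_derivative f (at x))"

definition hessian :: "('a::real_normed_vector \<Rightarrow> real) \<Rightarrow> 'a \<Rightarrow> 'a \<Rightarrow>\<^sub>L ('a \<Rightarrow>\<^sub>L real)" where
  "hessian f = grad (grad f)"

definition dir_deriv :: "nat \<Rightarrow> ('a::real_normed_vector \<Rightarrow> real) \<Rightarrow> 'a \<Rightarrow> 'a \<Rightarrow> real" where
  "dir_deriv k f x h = (deriv ^^ k) (\<lambda>t::real. f (x + t *\<^sub>R h)) 0"

definition C3_on :: "'a::real_normed_vector set \<Rightarrow> ('a \<Rightarrow> real) \<Rightarrow> bool" where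
  "C3_on D f \<longleftrightarrow>
     (\<forall>x\<in>D. f differentiable (at x) \<and> grad f differentiable (at x) \<and>
             hessian f differentiable (at x)) \<and>
     continuous_on D (grad (hessian f))"

definition self_concordant :: "'a::real_normed_vector set \<Rightarrow> ('a \<Rightarrow> real) \<Rightarrow> bool" where
  "self_concordant D f \<longleftrightarrow>
     open D \<and> convex_on D f \<and> closed (epigraph D f) \<and> C3_on D f \<and>
     (\<forall>x\<in>D. \<forall>h. dir_deriv 3 f x h \<le> 2 * dir_deriv 2 f x h powr (3/2))"

definition self_concordant_barrier ::
    "'a::real_normed_vector set \<Rightarrow> ('a \<Rightarrow> real) \<Rightarrow> real \<Rightarrow> bool" where
  "self_concordant_barrier D F \<nu> \<longleftrightarrow>
     self_concordant D F \<and> \<nu> \<ge> 1 \<and>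
     (\<forall>x\<in>D. \<forall>h. (grad F x h)\<^sup>2 \<le> \<nu> * (hessian F x h) h)"

definition proper_cone :: "'a::real_normed_vector set \<Rightarrow> bool" where
  "proper_cone K \<longleftrightarrow>
     cone K \<and> closed K \<and> convex K \<and> \<not> (\<exists>x d. d \<noteq> 0 \<and> (\<forall>t::real. x + t *\<^sub>R d \<in> K))"

definition log_homogeneous_barrier ::
    "'a::real_normed_vector set \<Rightarrow> ('a \<Rightarrow> real) \<Rightarrow> real \<Rightarrow> bool" where
  "log_homogeneous_barrier K F \<nu> \<longleftrightarrow>
     self_concordant_barrier (interior K) F \<nu> \<and>
     (\<forall>x\<in>interior K. \<forall>\<tau>>0. F (\<tau> *\<^sub>R x) = F x - \<nu> * ln \<tau>)"

definition dual_cone :: "'a::real_normed_vector set \<Rightarrow> ('a \<Rightarrow>\<^sub>L real) set" where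
  "dual_cone K = {s :: 'a \<Rightarrow>\<^sub>L real. \<forall>x\<in>K. 0 \<le> s x}"

text \<open>\<open>GREATEST\<close> is an attained maximum, not a supremum.\<close>

definition dual_barrier ::
    "'a::real_normed_vector set \<Rightarrow> ('a \<Rightarrow> real) \<Rightarrow> ('a \<Rightarrow>\<^sub>L real) \<Rightarrow> real" where
  "dual_barrier K F s = (GREATEST v. v \<in> (\<lambda>x. - s x - F x) ` interior K)"

text \<open>
  The gradient of a function on the dual space, as an element of the primal space: the bidual is
  identified with \<open>'a\<close> through evaluation.
\<close>

definition dual_grad ::
    "(('a::real_normed_vector \<Rightarrow>\<^sub>L real) \<Rightarrow> real) \<Rightarrow> ('a \<Rightarrow>\<^sub>L real) \<Rightarrow> 'a" where
  "dual_grad G s = (THE y. (G has_derivative (\<lambda>u. blinfun_apply u y)) (at s))"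

end

theory Submission
  imports Defs
begin

text \<open>
  The maximum defining \<open>dual_barrier K F s\<close> is attained at the unique point \<open>y\<close> with
  \<open>grad F y = - s\<close>. Euler's identity \<open>grad F y y = - \<nu>\<close> makes its value \<open>- \<nu> - F y\<close>, and the
  envelope theorem gives \<open>dual_grad (dual_barrier K F) s = - y\<close>. So the middle term is \<open>F x - F y\<close>,
  and both bounds are the tangent inequality for \<open>F\<close> along a ray: at \<open>x\<close> along the ray of \<open>y\<close> for
  the upper bound, with \<open>x\<close> and \<open>y\<close> exchanged for the lower one. Equality means that \<open>x\<close> and \<open>y\<close>
  span the same ray, since \<open>F\<close> is strictly convex: where the Hessian degenerates in a direction,
  self-concordance propagates the degeneracy, so that the closed epigraph, hence \<open>K\<close>, would contain
  a line.
\<close>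

section \<open>Derivatives along lines\<close>

lemma grad_has_derivative:
  assumes "f differentiable (at x)"
  shows "(f has_derivative blinfun_apply (grad f x)) (at x)"
  unfolding grad_def using assms
  by (metis bounded_linear_Blinfun_apply frechet_derivative_works has_derivative_bounded_linear)

lemma grad_eqI:
  assumes "(f has_derivative blinfun_apply d) (at x)"
  shows "grad f x = d"
  unfolding grad_def frechet_derivative_at[OF assms, symmetric] by (rule blinfun_apply_inverse)

lemma has_derivative_along_line:
  assumes "(g has_derivative g') (at (x + t *\<^sub>R h))"
  shows "((\<lambda>t. g (x + t *\<^sub>R h)) has_derivative (\<lambda>r. g' (r *\<^sub>R h))) (at t)"
proof -
  have "((\<lambda>t. x + t *\<^sub>R h) has_derivative (\<lambda>r. r *\<^sub>R h)) (at t)"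
    by (auto intro!: derivative_eq_intros)
  from has_derivative_compose[OF this assms] show ?thesis .
qed

lemma C3_on_line_derivatives:
  assumes "C3_on D f" and "x + t *\<^sub>R h \<in> D"
  shows "((\<lambda>t. f (x + t *\<^sub>R h)) has_real_derivative grad f (x + t *\<^sub>R h) h) (at t)"
    and "((\<lambda>t. grad f (x + t *\<^sub>R h) h) has_real_derivative hessian f (x + t *\<^sub>R h) h h) (at t)"
    and "((\<lambda>t. hessian f (x + t *\<^sub>R h) h h) has_real_derivative
      grad (hessian f) (x + t *\<^sub>R h) h h h) (at t)"
proof -
  let ?p = "x + t *\<^sub>R h"
  have f: "(f has_derivative blinfun_apply (grad f ?p)) (at ?p)"
    and g: "(grad f has_derivative blinfun_apply (hessian f ?p)) (at ?p)"
    and H: "(hessian f has_derivative blinfun_apply (grad (hessian f) ?p)) (at ?p)"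
    using assms by (auto simp: C3_on_def hessian_def intro: grad_has_derivative)
  show "((\<lambda>t. f (x + t *\<^sub>R h)) has_real_derivative grad f ?p h) (at t)"
    by (rule has_derivative_imp_has_field_derivative[OF has_derivative_along_line[OF f]])
      (simp add: blinfun.scaleR_right)
  note left = bounded_linear.has_derivative[OF blinfun.bounded_linear_left]
  show "((\<lambda>t. grad f (x + t *\<^sub>R h) h) has_real_derivative hessian f ?p h h) (at t)"
    by (rule has_derivative_imp_has_field_derivative[OF left[OF has_derivative_along_line[OF g]]])
      (simp add: blinfun.scaleR_right blinfun.scaleR_left)
  show "((\<lambda>t. hessian f (x + t *\<^sub>R h) h h) has_real_derivative grad (hessian f) ?p h h h) (at t)"
    by (rule has_derivative_imp_has_field_derivative[OF left[OF left[OF has_derivative_along_line[OF H]]]])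
      (simp add: blinfun.scaleR_right blinfun.scaleR_left)
qed

lemma C3_on_dir_deriv:
  assumes D: "open D" and f: "C3_on D f" and x: "x \<in> D"
  shows "dir_deriv 2 f x h = hessian f x h h"
    and "dir_deriv 3 f x h = grad (hessian f) x h h h"
proof -
  \<comment> \<open>Iterating \<open>deriv\<close> needs each formula on a whole neighbourhood of
    the parameter; the open set \<open>S\<close> supplies it.\<close>
  define S where "S = {t. x + t *\<^sub>R h \<in> D}"
  let ?f = "\<lambda>t. f (x + t *\<^sub>R h)"
  have S: "open S"
    unfolding S_def vimage_def[symmetric] by (intro open_vimage D continuous_intros)
  have S0: "0 \<in> S"
    using x by (simp add: S_def)
  have "x + t *\<^sub>R h \<in> D" if "t \<in> S" for t
    using that by (simp add: S_def)
  note C = C3_on_line_derivatives[OF f this]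
  have d1: "deriv ?f t = grad f (x + t *\<^sub>R h) h" if "t \<in> S" for t
    using C(1)[OF that] by (rule DERIV_imp_deriv)
  have d2: "deriv (deriv ?f) t = hessian f (x + t *\<^sub>R h) h h" if t: "t \<in> S" for t
    by (intro DERIV_imp_deriv has_field_derivative_transform_within_open[OF C(2)[OF t] S t])
      (simp add: d1)
  have d3: "deriv (deriv (deriv ?f)) t = grad (hessian f) (x + t *\<^sub>R h) h h h" if t: "t \<in> S" for t
    by (intro DERIV_imp_deriv has_field_derivative_transform_within_open[OF C(3)[OF t] S t])
      (simp add: d2)
  show "dir_deriv 2 f x h = hessian f x h h" "dir_deriv 3 f x h = grad (hessian f) x h h h"
    using d2[OF S0] d3[OF S0] by (auto simp: dir_deriv_def numeral_2_eq_2 numeral_3_eq_3)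
qed

section \<open>Degenerate directions of the Hessian\<close>

text \<open>
  Along the segment the second derivative \<open>u\<close> satisfies \<open>u' \<le> 2 u\<^sup>3\<^sup>/\<^sup>2 \<le> C u\<close>, so it stays zero by
  Gronwall, and the barrier inequality then kills the first derivative.
\<close>

lemma self_concordant_barrier_const_segment:
  assumes F: "self_concordant_barrier D F \<nu>" and h: "hessian F y h h = 0"
    and T: "0 \<le> T" and D: "\<And>t. 0 \<le> t \<Longrightarrow> t \<le> T \<Longrightarrow> y + t *\<^sub>R h \<in> D"
  shows "F (y + T *\<^sub>R h) = F y"
proof -
  define u where "u t = hessian F (y + t *\<^sub>R h) h h" for t
  define u' where "u' t = grad (hessian F) (y + t *\<^sub>R h) h h h" for t
  have C3: "C3_on D F" and op: "open D"
    and sc: "\<And>x h. x \<in> D \<Longrightarrow> dir_deriv 3 F x h \<le> 2 * dir_deriv 2 F x h powr (3/2)"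
    and nu: "1 \<le> \<nu>" and bar: "\<And>x h. x \<in> D \<Longrightarrow> (grad F x h)\<^sup>2 \<le> \<nu> * hessian F x h h"
    using F by (auto simp: self_concordant_barrier_def self_concordant_def)
  have u_nonneg: "0 \<le> u t" if "0 \<le> t" "t \<le> T" for t
    using bar[OF D[OF that], of h] nu zero_le_power2[of "grad F (y + t *\<^sub>R h) h"]
    unfolding u_def by (smt (verit) mult_pos_neg)
  have du: "(u has_real_derivative u' t) (at t)" if "0 \<le> t" "t \<le> T" for t
    unfolding u_def u'_def by (rule C3_on_line_derivatives(3)[OF C3 D[OF that]])
  have "continuous_on {0..T} u"
    by (rule DERIV_continuous_on[where D = u']) (auto intro: has_field_derivative_at_within du)
  then obtain r where "\<forall>t\<in>{0..T}. u t \<le> u r"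
    using continuous_attains_sup[of "{0..T}" u] T by auto
  then obtain M where M: "\<And>t. 0 \<le> t \<Longrightarrow> t \<le> T \<Longrightarrow> u t \<le> M"
    by (meson atLeastAtMost_iff)
  \<comment> \<open>With \<open>M\<close> a bound for \<open>u\<close> on the segment, 2 u^(3/2) = 2
    u sqrt u is at most 2 (sqrt M) u, so the differential inequality becomes linear.\<close>
  define C where "C = 2 * sqrt M"
  have u'_le: "u' t \<le> C * u t" if "0 \<le> t" "t \<le> T" for t
  proof -
    have "u' t \<le> 2 * u t powr (3/2)"
      using sc[OF D[OF that], of h] C3_on_dir_deriv[OF op C3 D[OF that], of h]
      by (simp add: u_def u'_def)
    moreover have "u t powr (3/2) = u t * sqrt (u t)"
      using u_nonneg[OF that] powr_add[of "u t" 1 "1/2"] by (simp add: powr_half_sqrt)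
    moreover have "u t * sqrt (u t) \<le> u t * sqrt M"
      using M[OF that] u_nonneg[OF that] by (intro mult_left_mono) auto
    ultimately show ?thesis by (simp add: C_def mult_ac)
  qed
  have u0: "u t = 0" if t: "0 \<le> t" "t \<le> T" for t
  proof -
    \<comment> \<open>The integrating factor turns \<open>u' \<le> C u\<close> into monotone
      decrease from the value 0.\<close>
    have "u t * exp (- C * t) \<le> u 0 * exp (- C * 0)"
    proof (rule DERIV_nonpos_imp_nonincreasing[where f = "\<lambda>t. u t * exp (- C * t)", OF t(1)])
      fix r assume r: "0 \<le> r" "r \<le> t"
      have du_r: "(u has_real_derivative u' r) (at r)"
        using r t by (intro du) auto
      have "((\<lambda>t. u t * exp (- C * t)) has_real_derivative
          (u' r - C * u r) * exp (- C * r)) (at r)"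
        by (rule derivative_eq_intros du_r refl | simp add: algebra_simps)+
      moreover have "(u' r - C * u r) * exp (- C * r) \<le> 0"
        using u'_le[of r] r t by (intro mult_nonpos_nonneg) auto
      ultimately show "\<exists>d. ((\<lambda>t. u t * exp (- C * t)) has_real_derivative d) (at r) \<and> d \<le> 0"
        by blast
    qed
    then have "u t \<le> 0"
      using h by (simp add: u_def mult_le_0_iff)
    then show ?thesis using u_nonneg[OF t] by simp
  qed
  have d: "((\<lambda>t. F (y + t *\<^sub>R h)) has_real_derivative 0) (at t)" if t: "0 \<le> t" "t \<le> T" for t
    using C3_on_line_derivatives(1)[OF C3 D[OF t]] bar[OF D[OF t], of h] u0[OF t]
    by (simp add: u_def)
  show ?thesis
  proof (cases "T = 0")
    case False
    have "continuous_on {0..T} (\<lambda>t. F (y + t *\<^sub>R h))"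
      by (rule DERIV_continuous_on[where D = "\<lambda>_. 0"]) (auto intro: has_field_derivative_at_within d)
    then have "F (y + T *\<^sub>R h) = F (y + 0 *\<^sub>R h)"
      using T False by (intro DERIV_isconst_end[where f = "\<lambda>t. F (y + t *\<^sub>R h)"]) (auto intro: d)
    then show ?thesis by simp
  qed simp
qed

text \<open>The admissible parameters form a clopen subset of the half-line: relatively open because
  \<open>D\<close> is open, relatively closed because \<open>F\<close> keeps the value
  \<open>F y\<close> on them, so that they are cut out by the closed epigraph at that
  height.\<close>

lemma self_concordant_barrier_degenerate_ray:
  assumes F: "self_concordant_barrier D F \<nu>" and y: "y \<in> D"
    and h: "hessian F y h h = 0" and t: "0 \<le> t"
  shows "y + t *\<^sub>R h \<in> D"
proof -
  define A where "A = {t\<in>{0..}. y + t *\<^sub>R h \<in> D}"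
  have op: "open D" and cv: "convex D" and ep: "closed (epigraph D F)"
    using F by (auto simp: self_concordant_barrier_def self_concordant_def convex_on_def)
  have const: "F (y + T *\<^sub>R h) = F y" if T: "T \<in> A" for T
  proof (rule self_concordant_barrier_const_segment[OF F h])
    show "0 \<le> T" using T by (simp add: A_def)
    fix t assume t: "0 \<le> t" "t \<le> T"
    then have "y + t *\<^sub>R h = (1 - t / T) *\<^sub>R y + (t / T) *\<^sub>R (y + T *\<^sub>R h)"
      by (cases "T = 0") (auto simp: algebra_simps)
    also have "\<dots> \<in> D"
      using t T y by (intro convexD_alt[OF cv]) (auto simp: A_def divide_le_eq_1)
    finally show "y + t *\<^sub>R h \<in> D" .
  qed
  have "A = {0..} \<inter> {t. y + t *\<^sub>R h \<in> D}"
    by (auto simp: A_def)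
  moreover have "open {t. y + t *\<^sub>R h \<in> D}"
    unfolding vimage_def[symmetric] by (intro open_vimage op continuous_intros)
  ultimately have "openin (top_of_set {0..}) A"
    by (simp add: openin_open_Int)
  moreover have "A = {0..} \<inter> {t. (y + t *\<^sub>R h, F y) \<in> epigraph D F}"
    using const by (auto simp: A_def epigraph_def)
  moreover have "closed {t. (y + t *\<^sub>R h, F y) \<in> epigraph D F}"
    unfolding vimage_def[symmetric] by (intro closed_vimage ep continuous_intros)
  ultimately have "closedin (top_of_set {0..}) A" "openin (top_of_set {0..}) A"
    by (auto simp: closedin_closed_Int)
  moreover have "0 \<in> A"
    using y by (simp add: A_def)
  ultimately have "A = {0..}"
    using connected_clopen[of "{0::real..}"] by auto
  then show ?thesis using t by (auto simp: A_def)
qed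

section \<open>Strict convexity on a pointed cone and the gradient equation\<close>

locale proper_cone_barrier =
  fixes K :: "'a::euclidean_space set" and F :: "'a \<Rightarrow> real" and \<nu> :: real
  assumes proper: "proper_cone K" and barrier: "log_homogeneous_barrier K F \<nu>"
begin

abbreviation D where "D \<equiv> interior K"

lemma scb: "self_concordant_barrier D F \<nu>"
  and log_hom: "x \<in> D \<Longrightarrow> 0 < \<tau> \<Longrightarrow> F (\<tau> *\<^sub>R x) = F x - \<nu> * ln \<tau>"
  using barrier by (auto simp: log_homogeneous_barrier_def)

lemma nu_pos: "0 < \<nu>"
  and C3: "C3_on D F"
  and convex_D: "convex D"
  and closed_epigraph: "closed (epigraph D F)"
  using scb by (auto simp: self_concordant_barrier_def self_concordant_def convex_on_def)

lemma F_has_derivative: "x \<in> D \<Longrightarrow> (F has_derivative blinfun_apply (grad F x)) (at x)"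
  using C3 by (intro grad_has_derivative) (auto simp: C3_on_def)

lemma scaleR_interior:
  assumes "x \<in> D" "0 < \<tau>"
  shows "\<tau> *\<^sub>R x \<in> D"
proof -
  have "(*\<^sub>R) \<tau> ` D \<subseteq> K"
    using proper interior_subset[of K] assms(2) by (force simp: proper_cone_def cone_def)
  moreover have "open ((*\<^sub>R) \<tau> ` D)"
    using assms(2) by (intro open_scaling) auto
  ultimately have "(*\<^sub>R) \<tau> ` D \<subseteq> D"
    by (rule interior_maximal)
  then show ?thesis using assms(1) by blast
qed

text \<open>If the Hessian vanishes on \<open>h\<close>, it vanishes on \<open>- h\<close> too; the
  two degenerate rays then form a line in \<open>K\<close>, against pointedness. Nonnegativity comes
  from the barrier inequality.\<close>

lemma hessian_pos:
  assumes y: "y \<in> D" and h: "h \<noteq> 0"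
  shows "0 < hessian F y h h"
proof -
  have bar: "(grad F y h)\<^sup>2 \<le> \<nu> * hessian F y h h"
    using scb y by (simp add: self_concordant_barrier_def)
  have "hessian F y h h \<noteq> 0"
  proof
    assume zero: "hessian F y h h = 0"
    then have neg: "hessian F y (- h) (- h) = 0"
      by (simp add: blinfun.minus_right blinfun.minus_left)
    have "y + t *\<^sub>R h \<in> K" for t
      using self_concordant_barrier_degenerate_ray[OF scb y zero, of t]
        self_concordant_barrier_degenerate_ray[OF scb y neg, of "- t"] interior_subset[of K]
      by (cases "0 \<le> t") auto
    then show False
      using proper h by (auto simp: proper_cone_def)
  qed
  moreover have "0 \<le> hessian F y h h"
    using bar nu_pos zero_le_power2[of "grad F y h"] by (smt (verit) mult_pos_neg)
  ultimately show ?thesis by simp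
qed

text \<open>Two mean value steps: the increment is the slope at an intermediate \<open>t\<close>,
  which exceeds the slope at 0 by \<open>t\<close> times a positive Hessian value.\<close>

lemma strict_tangent:
  assumes x: "x \<in> D" and z: "z \<in> D" and "x \<noteq> z"
  shows "F x + grad F x (z - x) < F z"
proof -
  define h where "h = z - x"
  have h: "h \<noteq> 0" using assms by (simp add: h_def)
  have in_D: "x + t *\<^sub>R h \<in> D" if "0 \<le> t" "t \<le> 1" for t
    using convexD_alt[OF convex_D x z that] by (simp add: h_def algebra_simps)
  note d = C3_on_line_derivatives[OF C3 in_D]
  obtain t where t: "0 < t" "t < 1" "F (x + 1 *\<^sub>R h) - F (x + 0 *\<^sub>R h) = (1 - 0) * grad F (x + t *\<^sub>R h) h"
    using MVT2[OF zero_less_one d(1)] by blast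
  obtain r where r: "0 < r" "r < t"
    "grad F (x + t *\<^sub>R h) h - grad F (x + 0 *\<^sub>R h) h = (t - 0) * hessian F (x + r *\<^sub>R h) h h"
    using MVT2[OF t(1), of "\<lambda>t. grad F (x + t *\<^sub>R h) h" "\<lambda>t. hessian F (x + t *\<^sub>R h) h h"] d(2) t(2)
    by auto
  have "0 < hessian F (x + r *\<^sub>R h) h h"
    using r t h by (intro hessian_pos in_D) auto
  then have "0 < t * hessian F (x + r *\<^sub>R h) h h"
    using t by simp
  with r t show ?thesis by (simp add: h_def)
qed

lemma tangent:
  assumes "x \<in> D" "z \<in> D"
  shows "F x + grad F x (z - x) \<le> F z"
  using strict_tangent[OF assms] by (cases "x = z") (auto simp: blinfun.zero_right)

text \<open>Bridge between the maximum in \<open>dual_barrier\<close> and a gradient equation: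
  stationarity suffices by the tangent inequality and is necessary at an interior minimum.\<close>

lemma grad_eq_neg_iff:
  assumes y: "y \<in> D"
  shows "grad F y = - s \<longleftrightarrow> (\<forall>z\<in>D. s y + F y \<le> s z + F z)"
proof
  assume s: "grad F y = - s"
  show "\<forall>z\<in>D. s y + F y \<le> s z + F z"
  proof
    fix z assume "z \<in> D"
    from tangent[OF y this] show "s y + F y \<le> s z + F z"
      by (simp add: s blinfun.diff_right blinfun.minus_left)
  qed
next
  assume min: "\<forall>z\<in>D. s y + F y \<le> s z + F z"
  have "((\<lambda>z. s z + F z) has_derivative blinfun_apply (s + grad F y)) (at y)"
    using F_has_derivative[OF y] by (auto intro!: derivative_eq_intros simp: blinfun.add_left)
  from differential_zero_maxmin[OF y open_interior this] min
  have "blinfun_apply (s + grad F y) = (\<lambda>v. 0)" by blast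
  then have "s + grad F y = 0"
    by (intro blinfun_eqI) (simp add: blinfun.zero_left)
  then show "grad F y = - s"
    by (simp add: eq_neg_iff_add_eq_0 add.commute)
qed

lemma grad_inj:
  assumes "x \<in> D" "y \<in> D" "grad F x = grad F y"
  shows "x = y"
  using strict_tangent[of x y] strict_tangent[of y x] assms
  by (force simp: blinfun.diff_right)

section \<open>Logarithmic homogeneity and the value of the dual barrier\<close>

text \<open>Differentiate the homogeneity identity in the point; the term in
  \<open>ln \<tau>\<close> is a constant and drops out.\<close>

lemma grad_scaleR:
  assumes x: "x \<in> D" and \<tau>: "0 < \<tau>"
  shows "grad F (\<tau> *\<^sub>R x) = (1 / \<tau>) *\<^sub>R grad F x"
proof -
  have "((\<lambda>z. F (\<tau> *\<^sub>R z)) has_derivative (\<lambda>h. grad F (\<tau> *\<^sub>R x) (\<tau> *\<^sub>R h))) (at x)"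
    by (rule has_derivative_compose[where f = "\<lambda>z. \<tau> *\<^sub>R z" and g = F,
          OF _ F_has_derivative[OF scaleR_interior[OF assms]]])
      (auto intro!: derivative_eq_intros)
  then have "((\<lambda>z. F (\<tau> *\<^sub>R z) + \<nu> * ln \<tau>) has_derivative blinfun_apply (\<tau> *\<^sub>R grad F (\<tau> *\<^sub>R x))) (at x)"
    by (auto intro!: derivative_eq_intros simp: blinfun.scaleR_left blinfun.scaleR_right)
  then have "(F has_derivative blinfun_apply (\<tau> *\<^sub>R grad F (\<tau> *\<^sub>R x))) (at x)"
    by (rule has_derivative_transform_within_open[OF _ open_interior x]) (simp add: log_hom \<tau>)
  then show ?thesis
    using \<tau> by (simp add: grad_eqI)
qed

lemma euler:
  assumes x: "x \<in> D"
  shows "grad F x x = - \<nu>"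
proof -
  \<comment> \<open>The ray is written as a line based at 0; only its point at \<open>t = 1\<close>
    has to lie in \<open>D\<close>. Homogeneity gives a second expression for the same
    derivative.\<close>
  have "((\<lambda>t. F (0 + t *\<^sub>R x)) has_real_derivative grad F (0 + 1 *\<^sub>R x) x) (at 1)"
    using x by (intro C3_on_line_derivatives[OF C3]) simp
  then have "((\<lambda>t. F (t *\<^sub>R x)) has_real_derivative grad F x x) (at 1)" by simp
  moreover have "((\<lambda>t. F x - \<nu> * ln t) has_real_derivative - \<nu>) (at 1)"
    by (auto intro!: derivative_eq_intros)
  then have "((\<lambda>t. F (t *\<^sub>R x)) has_real_derivative - \<nu>) (at 1)"
    by (rule has_field_derivative_transform_within_open[where S = "{0<..}"]) (auto simp: log_hom x)
  ultimately show ?thesis by (rule DERIV_unique)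
qed

lemma dual_barrier_eq:
  assumes y: "y \<in> D" and s: "grad F y = - s"
  shows "dual_barrier K F s = - \<nu> - F y"
proof -
  have "dual_barrier K F s = - s y - F y"
    unfolding dual_barrier_def
    using y grad_eq_neg_iff[OF y, of s] s by (intro Greatest_equality) force+
  moreover have "s y = \<nu>"
    using euler[OF y] by (simp add: s blinfun.minus_left)
  ultimately show ?thesis by simp
qed

section \<open>Attainment of the maximum\<close>

text \<open>A whole ball around \<open>s\<close> is nonnegative on \<open>K\<close>, so
  \<open>s\<close> may be lowered by a functional of norm at most \<open>\<delta>\<close> chosen to
  be largest at \<open>z\<close>. This coercivity bounds the slices of \<open>K\<close> by
  \<open>s\<close>.\<close>

lemma dual_cone_interior_lower_bound:
  assumes s: "s \<in> interior (dual_cone K)"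
  obtains \<delta> where "0 < \<delta>" "\<And>z. z \<in> K \<Longrightarrow> \<delta> * norm z \<le> s z"
proof -
  obtain \<delta> where \<delta>: "0 < \<delta>" "cball s \<delta> \<subseteq> dual_cone K"
    using s by (meson mem_interior_cball)
  have "\<delta> * norm z \<le> s z" if z: "z \<in> K" for z
  proof -
    \<comment> \<open>The functional aligned with \<open>z\<close>, scaled so that
      \<open>u z = \<delta> * norm z\<close>; for \<open>z = 0\<close> division by zero makes it
      0.\<close>
    define u where "u = (\<delta> / norm z) *\<^sub>R blinfun_inner_left z"
    have "norm u \<le> \<delta>"
    proof (rule norm_blinfun_bound)
      fix w show "norm (blinfun_apply u w) \<le> \<delta> * norm w"
      proof (cases "z = 0")
        case False
        have "\<delta> / norm z * \<bar>w \<bullet> z\<bar> \<le> \<delta> / norm z * (norm w * norm z)"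
          using \<delta>(1) by (intro mult_left_mono Cauchy_Schwarz_ineq2) auto
        then show ?thesis
          using False \<delta>(1) by (simp add: u_def blinfun.scaleR_left abs_mult)
      qed (use \<delta>(1) in \<open>simp add: u_def\<close>)
    qed (use \<delta>(1) in simp)
    then have "s - u \<in> dual_cone K"
      using \<delta>(2) by (auto simp: dist_norm)
    then have "u z \<le> s z"
      using z by (auto simp: dual_cone_def blinfun.diff_left)
    moreover have "u z = \<delta> * norm z"
      by (cases "z = 0") (auto simp: u_def blinfun.scaleR_left dot_square_norm power2_eq_square)
    ultimately show ?thesis by simp
  qed
  with \<delta>(1) show thesis by (rule that)
qed

lemma zero_notin_interior: "0 \<notin> D"
  using euler[of 0] nu_pos by (auto simp: blinfun.zero_right)

lemma dual_cone_interior_pos: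
  assumes "s \<in> interior (dual_cone K)" "x \<in> D"
  shows "0 < s x"
proof -
  obtain \<delta> where \<delta>: "0 < \<delta>" "\<And>z. z \<in> K \<Longrightarrow> \<delta> * norm z \<le> s z"
    using dual_cone_interior_lower_bound[OF assms(1)] by blast
  have "x \<noteq> 0" using zero_notin_interior assms(2) by auto
  then have "0 < \<delta> * norm x" using \<delta>(1) by simp
  also have "\<dots> \<le> s x"
    using assms(2) interior_subset by (intro \<delta>(2)) blast
  finally show ?thesis .
qed

text \<open>First half of the existence argument: minimize \<open>F\<close> on the slice
  \<open>s z = \<nu>\<close>, the level that Euler's identity forces on any solution of
  \<open>grad F y = - s\<close>.\<close>

lemma slice_minimizer:
  assumes x: "x \<in> D" and s: "s \<in> interior (dual_cone K)"
  obtains y where "y \<in> D" "s y = \<nu>" "\<And>z. z \<in> D \<Longrightarrow> s z = \<nu> \<Longrightarrow> F y \<le> F z"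
proof -
  define x1 where "x1 = (\<nu> / s x) *\<^sub>R x"
  have sx: "0 < s x" by (rule dual_cone_interior_pos[OF s x])
  have x1: "x1 \<in> D" "s x1 = \<nu>"
    using sx nu_pos scaleR_interior[OF x] by (auto simp: x1_def blinfun.scaleR_right)
  obtain \<delta> where \<delta>: "0 < \<delta>" "\<And>z. z \<in> K \<Longrightarrow> \<delta> * norm z \<le> s z"
    using dual_cone_interior_lower_bound[OF s] by blast
  \<comment> \<open>The slice of the open set \<open>D\<close> need not be closed, so compactness is
    sought in the closed epigraph and the height \<open>snd\<close> is minimized there. Capping at
    \<open>F x1\<close> keeps the set bounded above.\<close>
  define C where "C = epigraph D F \<inter> {p. s (fst p) = \<nu>} \<inter> {p. snd p \<le> F x1}"
  have "closed {p :: 'a \<times> real. s (fst p) = \<nu>}" "closed {p :: 'a \<times> real. snd p \<le> F x1}"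
    by (intro closed_Collect_eq closed_Collect_le continuous_intros)+
  then have "closed C"
    unfolding C_def using closed_epigraph by (intro closed_Int)
  \<comment> \<open>Coercivity of \<open>s\<close> bounds the points; the tangent plane of
    \<open>F\<close> at \<open>x1\<close> bounds the heights from below.\<close>
  moreover have "C \<subseteq> cball 0 (\<nu> / \<delta>) \<times> {F x1 - norm (grad F x1) * (\<nu> / \<delta> + norm x1)..F x1}"
  proof clarify
    fix z r assume "(z, r) \<in> C"
    then have z: "z \<in> D" "s z = \<nu>" "F z \<le> r" "r \<le> F x1"
      by (auto simp: C_def epigraph_def)
    have nz: "norm z \<le> \<nu> / \<delta>"
      using \<delta>(1) \<delta>(2)[of z] z interior_subset[of K] by (auto simp: field_simps)
    have "\<bar>grad F x1 (z - x1)\<bar> \<le> norm (grad F x1) * norm (z - x1)"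
      using norm_blinfun[of "grad F x1" "z - x1"] by simp
    also have "\<dots> \<le> norm (grad F x1) * (\<nu> / \<delta> + norm x1)"
      using nz norm_triangle_ineq4[of z x1] by (intro mult_left_mono) auto
    finally show "z \<in> cball 0 (\<nu> / \<delta>) \<and> r \<in> {F x1 - norm (grad F x1) * (\<nu> / \<delta> + norm x1)..F x1}"
      using tangent[OF x1(1) z(1)] z nz by auto
  qed
  then have "bounded C"
    by (rule bounded_subset[OF bounded_Times[OF bounded_cball bounded_closed_interval]])
  ultimately have "compact C"
    by (simp add: compact_eq_bounded_closed)
  moreover have x1C: "(x1, F x1) \<in> C"
    using x1 by (auto simp: C_def epigraph_def)
  moreover have "continuous_on C snd"
    by (intro continuous_intros)
  ultimately obtain p where p: "p \<in> C" "\<And>q. q \<in> C \<Longrightarrow> snd p \<le> snd q"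
    using continuous_attains_inf[of C snd] by blast
  obtain y r where yr: "p = (y, r)" by fastforce
  have y: "y \<in> D" "s y = \<nu>" "F y \<le> r"
    using p(1) by (auto simp: yr C_def epigraph_def)
  have "F y \<le> F z" if z: "z \<in> D" "s z = \<nu>" for z
  proof (cases "F z \<le> F x1")
    case True
    then have "(z, F z) \<in> C" using z by (auto simp: C_def epigraph_def)
    from p(2)[OF this] show ?thesis using y by (simp add: yr)
  next
    case False
    then show ?thesis using p(2)[OF x1C] y by (simp add: yr)
  qed
  with y show thesis using that by blast
qed

text \<open>Second half: the slice minimizer is a global one. Any \<open>z\<close> in
  \<open>D\<close> is scaled by \<open>\<tau>\<close> onto the slice; the change in
  \<open>F\<close>, a logarithm, is controlled by \<open>ln t \<le> t - 1\<close>, which produces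
  exactly the linear term \<open>s z - \<nu>\<close>.\<close>

lemma exists_grad_eq:
  assumes x: "x \<in> D" and s: "s \<in> interior (dual_cone K)"
  obtains y where "y \<in> D" "grad F y = - s"
proof -
  obtain y where y: "y \<in> D" "s y = \<nu>" and min: "\<And>z. z \<in> D \<Longrightarrow> s z = \<nu> \<Longrightarrow> F y \<le> F z"
    using slice_minimizer[OF assms] by blast
  have "s y + F y \<le> s z + F z" if z: "z \<in> D" for z
  proof -
    have sz: "0 < s z" by (rule dual_cone_interior_pos[OF s z])
    define \<tau> where "\<tau> = \<nu> / s z"
    have \<tau>: "0 < \<tau>" using sz nu_pos by (simp add: \<tau>_def)
    have "F y \<le> F (\<tau> *\<^sub>R z)"
      using \<tau> sz z by (intro min scaleR_interior) (auto simp: \<tau>_def blinfun.scaleR_right)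
    also have "\<dots> = F z + \<nu> * ln (1 / \<tau>)"
      using \<tau> by (simp add: log_hom[OF z] ln_div)
    also have "\<dots> \<le> F z + \<nu> * (1 / \<tau> - 1)"
      using \<tau> nu_pos by (intro add_left_mono mult_left_mono ln_le_minus_one) auto
    also have "\<dots> = F z + s z - \<nu>"
      using nu_pos by (simp add: \<tau>_def right_diff_distrib)
    finally show ?thesis using y by simp
  qed
  with y that show thesis by (auto simp: grad_eq_neg_iff)
qed

section \<open>Differentiability and gradient of the dual barrier\<close>

text \<open>
  The objective for \<open>s + u\<close>, normalised to vanish at \<open>y\<close>, is positive on a small sphere around \<open>y\<close>
  as soon as \<open>u\<close> is small; by convexity its minimizer lies inside that sphere.
\<close>

lemma minimizer_continuous:
  assumes y: "y \<in> D" and s: "grad F y = - s" and \<epsilon>: "0 < \<epsilon>"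
  obtains d where "0 < d"
    "\<And>s' y'. norm (s' - s) < d \<Longrightarrow> y' \<in> D \<Longrightarrow> grad F y' = - s' \<Longrightarrow> norm (y' - y) \<le> \<epsilon>"
proof -
  obtain e0 where e0: "0 < e0" "cball y e0 \<subseteq> D"
    using y open_interior open_contains_cball by metis
  define e where "e = min e0 \<epsilon>"
  have e: "0 < e" "e \<le> \<epsilon>" "sphere y e \<subseteq> D"
    using e0 \<epsilon> by (auto simp: e_def)
  define G where "G z = s z + F z - (s y + F y)" for z
  have "continuous_on D F"
    using F_has_derivative by (auto intro!: continuous_at_imp_continuous_on has_derivative_continuous)
  then have "continuous_on (sphere y e) G"
    unfolding G_def using e(3) by (intro continuous_intros) (auto intro: continuous_on_subset)
  moreover have "sphere y e \<noteq> {}"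
    using e(1) by simp
  ultimately obtain w where w: "w \<in> sphere y e" "\<And>z. z \<in> sphere y e \<Longrightarrow> G w \<le> G z"
    using continuous_attains_inf[OF compact_sphere] by blast
  have "y \<noteq> w" using w(1) e(1) by auto
  then have Gw: "0 < G w"
    using strict_tangent[OF y, of w] w(1) e(3)
    by (auto simp: G_def s blinfun.diff_right blinfun.minus_left)
  \<comment> \<open>On the sphere of radius \<open>e\<close> the perturbation \<open>s' - s\<close>
    changes the normalised objective by less than its minimum \<open>G w\<close> once
    \<open>norm (s' - s) < G w / e\<close>.\<close>
  have "norm (y' - y) \<le> \<epsilon>"
    if u: "norm (s' - s) < G w / e" and y': "y' \<in> D" and s': "grad F y' = - s'" for s' y'
  proof (rule ccontr)
    assume "\<not> norm (y' - y) \<le> \<epsilon>"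
    then have big: "e < norm (y' - y)" using e(2) by simp
    \<comment> \<open>This \<open>t\<close> marks where the segment from \<open>y\<close> to
      \<open>y'\<close> crosses the sphere.\<close>
    define t where "t = e / norm (y' - y)"
    have "0 < norm (y' - y)" using big e(1) by linarith
    then have t: "0 < t" "t < 1"
      using big e(1) by (auto simp only: t_def divide_less_eq_1_pos intro!: divide_pos_pos)
    define z where "z = (1 - t) *\<^sub>R y + t *\<^sub>R y'"
    have zy: "z - y = t *\<^sub>R (y' - y)"
      by (simp add: z_def algebra_simps)
    have nz: "norm (z - y) = e"
      using big e(1) by (auto simp: zy t_def)
    then have z: "z \<in> sphere y e"
      by (simp add: dist_norm norm_minus_commute)
    have cvx: "convex_on D F"
      using scb by (auto simp: self_concordant_barrier_def self_concordant_def)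
    have "F z \<le> (1 - t) * F y + t * F y'"
      unfolding z_def using t y y' by (intro convex_onD[OF cvx]) auto
    moreover have "s' y' + F y' \<le> s' y + F y"
      using grad_eq_neg_iff[OF y', of s'] s' y by blast
    then have "t * (s' y' + F y') \<le> t * (s' y + F y)"
      using t by (intro mult_left_mono) auto
    moreover have "s' z = (1 - t) * s' y + t * s' y'"
      by (simp add: z_def blinfun.add_right blinfun.scaleR_right)
    ultimately have "s' z + F z \<le> s' y + F y"
      by (simp add: algebra_simps)
    then have "G z \<le> - (s' - s) (z - y)"
      by (simp add: G_def blinfun.diff_left blinfun.diff_right)
    also have "\<dots> \<le> norm (s' - s) * e"
      using norm_blinfun[of "s' - s" "z - y"] nz by simp
    also have "\<dots> < G w"
      using u e(1) by (simp add: pos_less_divide_eq)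
    finally show False using w(2)[OF z] by simp
  qed
  with Gw e(1) show thesis
    using that[of "G w / e"] by simp
qed

text \<open>Envelope argument: optimality of \<open>y\<close> for \<open>s\<close> and of
  \<open>y'\<close> for \<open>s'\<close> traps the first-order remainder between 0 and
  \<open>(s' - s) (y - y')\<close>, and \<open>y'\<close> tends to \<open>y\<close> as
  \<open>s'\<close> tends to \<open>s\<close>.\<close>

lemma dual_barrier_has_derivative:
  assumes y: "y \<in> D" and s: "grad F y = - s" and s_int: "s \<in> interior (dual_cone K)"
  shows "(dual_barrier K F has_derivative (\<lambda>u. blinfun_apply u (- y))) (at s)"
  unfolding has_derivative_at_alt
proof (intro conjI allI impI)
  show "bounded_linear (\<lambda>u. blinfun_apply u (- y))"
    by (rule blinfun.bounded_linear_left)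
  fix \<epsilon> :: real assume "0 < \<epsilon>"
  obtain d1 where d1: "0 < d1"
    "\<And>s' y'. norm (s' - s) < d1 \<Longrightarrow> y' \<in> D \<Longrightarrow> grad F y' = - s' \<Longrightarrow> norm (y' - y) \<le> \<epsilon>"
    using minimizer_continuous[OF y s \<open>0 < \<epsilon>\<close>] by blast
  obtain d2 where d2: "0 < d2" "ball s d2 \<subseteq> interior (dual_cone K)"
    using s_int by (meson open_interior open_contains_ball)
  have "norm (dual_barrier K F s' - dual_barrier K F s - (s' - s) (- y)) \<le> \<epsilon> * norm (s' - s)"
    if s': "norm (s' - s) < min d1 d2" for s'
  proof -
    have "s' \<in> interior (dual_cone K)"
      using s' d2(2) by (auto simp: dist_norm norm_minus_commute)
    then obtain y' where y': "y' \<in> D" "grad F y' = - s'"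
      using exists_grad_eq[OF y] by blast
    have "s y + F y \<le> s y' + F y'" "s' y' + F y' \<le> s' y + F y"
      using grad_eq_neg_iff[OF y, of s] grad_eq_neg_iff[OF y'(1), of s'] s y y' by blast+
    moreover have "s y = \<nu>" "s' y' = \<nu>"
      using euler[OF y] euler[OF y'(1)] by (auto simp: s y' blinfun.minus_left)
    ultimately have "\<bar>dual_barrier K F s' - dual_barrier K F s - (s' - s) (- y)\<bar> \<le> \<bar>(s' - s) (y' - y)\<bar>"
      using dual_barrier_eq[OF y s] dual_barrier_eq[OF y']
      by (simp add: blinfun.diff_left blinfun.diff_right blinfun.minus_right)
    also have "\<dots> \<le> norm (s' - s) * norm (y' - y)"
      using norm_blinfun[of "s' - s" "y' - y"] by simp
    also have "\<dots> \<le> norm (s' - s) * \<epsilon>"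
      using d1(2)[of s' y'] s' y' by (intro mult_left_mono) auto
    finally show ?thesis by (simp add: mult.commute)
  qed
  then show "\<exists>d>0. \<forall>s'. norm (s' - s) < d \<longrightarrow>
      norm (dual_barrier K F s' - dual_barrier K F s - (s' - s) (- y)) \<le> \<epsilon> * norm (s' - s)"
    using d1(1) d2(1) by (intro exI[of _ "min d1 d2"]) auto
qed

lemma dual_grad_eq:
  assumes "y \<in> D" "grad F y = - s" "s \<in> interior (dual_cone K)"
  shows "dual_grad (dual_barrier K F) s = - y"
  unfolding dual_grad_def
proof (rule the_equality)
  show *: "(dual_barrier K F has_derivative (\<lambda>u. blinfun_apply u (- y))) (at s)"
    by (rule dual_barrier_has_derivative[OF assms])
  fix z assume "(dual_barrier K F has_derivative (\<lambda>u. blinfun_apply u z)) (at s)"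
  from has_derivative_unique[OF this *]
  \<comment> \<open>Testing both derivatives on the functional given by \<open>z + y\<close>
    separates \<open>z\<close> from \<open>- y\<close>.\<close>
  have "blinfun_apply (blinfun_inner_left (z + y)) z = blinfun_apply (blinfun_inner_left (z + y)) (- y)"
    by metis
  then have "(z + y) \<bullet> (z + y) = 0"
    by (simp add: inner_add_left inner_add_right inner_commute)
  then show "z = - y"
    by (simp add: eq_neg_iff_add_eq_0)
qed

section \<open>Logarithmic bounds along rays and their equality cases\<close>

text \<open>
  The tangent inequality at \<open>x\<close>, tested at the point of the ray through \<open>y\<close> where
  \<open>- grad F x\<close> takes the value \<open>\<nu>\<close>.
\<close>

lemma log_tangent:
  assumes x: "x \<in> D" and y: "y \<in> D"
  shows "grad F x y < 0"
    and "F x - F y \<le> \<nu> * ln (- grad F x y / \<nu>)"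
    and "F x - F y = \<nu> * ln (- grad F x y / \<nu>) \<longleftrightarrow> (\<exists>\<mu>>0. y = \<mu> *\<^sub>R x)"
proof -
  have ray: "F x + \<tau> * grad F x y + \<nu> \<le> F y - \<nu> * ln \<tau>" if "0 < \<tau>" for \<tau>
    using tangent[OF x scaleR_interior[OF y that]] log_hom[OF y that] euler[OF x]
    by (simp add: blinfun.diff_right blinfun.scaleR_right)
  show neg: "grad F x y < 0"
  proof (rule ccontr)
    assume "\<not> grad F x y < 0"
    \<comment> \<open>This choice turns the right side of \<open>ray\<close> into
      \<open>F x\<close>, leaving \<open>\<tau> * grad F x y + \<nu> \<le> 0\<close>.\<close>
    define \<tau> where "\<tau> = exp ((F y - F x) / \<nu>)"
    have "0 \<le> \<tau> * grad F x y"
      using \<open>\<not> grad F x y < 0\<close> by (simp add: \<tau>_def)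
    then show False
      using ray[of \<tau>] nu_pos by (simp add: \<tau>_def)
  qed
  define \<tau> where "\<tau> = \<nu> / (- grad F x y)"
  have \<tau>: "0 < \<tau>" "\<tau> * grad F x y = - \<nu>" "ln (- grad F x y / \<nu>) = - ln \<tau>"
    using neg nu_pos divide_pos_pos[of \<nu> "- grad F x y"]
      ln_div[of "- grad F x y" \<nu>] ln_div[of \<nu> "- grad F x y"] by (auto simp: \<tau>_def)
  show "F x - F y \<le> \<nu> * ln (- grad F x y / \<nu>)"
    using ray[OF \<tau>(1)] \<tau> by simp
  show "F x - F y = \<nu> * ln (- grad F x y / \<nu>) \<longleftrightarrow> (\<exists>\<mu>>0. y = \<mu> *\<^sub>R x)"
  proof
    assume eq: "F x - F y = \<nu> * ln (- grad F x y / \<nu>)"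
    have "x = \<tau> *\<^sub>R y"
    proof (rule ccontr)
      assume "x \<noteq> \<tau> *\<^sub>R y"
      from strict_tangent[OF x scaleR_interior[OF y \<tau>(1)] this] show False
        using log_hom[OF y \<tau>(1)] euler[OF x] eq \<tau>
        by (simp add: blinfun.diff_right blinfun.scaleR_right)
    qed
    then have "y = (1 / \<tau>) *\<^sub>R x" using \<tau> by simp
    then show "\<exists>\<mu>>0. y = \<mu> *\<^sub>R x"
      using \<tau>(1) by (intro exI[of _ "1 / \<tau>"]) auto
  next
    assume "\<exists>\<mu>>0. y = \<mu> *\<^sub>R x"
    then obtain \<mu> where \<mu>: "0 < \<mu>" "y = \<mu> *\<^sub>R x" by blast
    then show "F x - F y = \<nu> * ln (- grad F x y / \<nu>)"
      using log_hom[OF x \<mu>(1)] euler[OF x] nu_pos by (simp add: blinfun.scaleR_right)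
  qed
qed

text \<open>Translates the equality condition on \<open>s\<close> into one on rays: the gradient is
  homogeneous of degree -1 and injective, so scaling \<open>grad F x\<close> by \<open>\<mu>\<close>
  corresponds to scaling \<open>x\<close> by \<open>1 / \<mu>\<close>.\<close>

lemma grad_proportional_iff:
  assumes x: "x \<in> D" and y: "y \<in> D" and s: "grad F y = - s"
  shows "(\<exists>\<mu>>0. s = - \<mu> *\<^sub>R grad F x) \<longleftrightarrow> (\<exists>\<mu>>0. y = \<mu> *\<^sub>R x)"
proof
  assume "\<exists>\<mu>>0. s = - \<mu> *\<^sub>R grad F x"
  then obtain \<mu> where \<mu>: "0 < \<mu>" "s = - \<mu> *\<^sub>R grad F x" by blast
  then have "grad F y = grad F ((1 / \<mu>) *\<^sub>R x)"
    using s by (simp add: grad_scaleR[OF x])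
  then have "y = (1 / \<mu>) *\<^sub>R x"
    using \<mu>(1) by (intro grad_inj y scaleR_interior x) auto
  then show "\<exists>\<mu>>0. y = \<mu> *\<^sub>R x"
    using \<mu>(1) by (intro exI[of _ "1 / \<mu>"]) auto
next
  assume "\<exists>\<mu>>0. y = \<mu> *\<^sub>R x"
  then obtain \<mu> where \<mu>: "0 < \<mu>" "y = \<mu> *\<^sub>R x" by blast
  then have "s = - (1 / \<mu>) *\<^sub>R grad F x"
    using s grad_scaleR[OF x \<mu>(1)] by (simp add: minus_equation_iff[of _ s])
  then show "\<exists>\<mu>>0. s = - \<mu> *\<^sub>R grad F x"
    using \<mu>(1) by (intro exI[of _ "1 / \<mu>"]) auto
qed

end

theorem lemma2p1:
  fixes K :: "'a::euclidean_space set" and F :: "'a \<Rightarrow> real" and \<nu> :: real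
    and x :: 'a and s :: "'a \<Rightarrow>\<^sub>L real"
  assumes "proper_cone K" and "interior K \<noteq> {}"
    and "log_homogeneous_barrier K F \<nu>"
    and "x \<in> interior K" and "s \<in> interior (dual_cone K)"
  shows "\<nu> * ln (\<nu> / s x) \<le> F x + dual_barrier K F s + \<nu> \<and>
    F x + dual_barrier K F s + \<nu>
      \<le> \<nu> * ln (grad F x (dual_grad (dual_barrier K F) s) / \<nu>) \<and>
    (\<nu> * ln (\<nu> / s x) = F x + dual_barrier K F s + \<nu>
      \<longleftrightarrow> (\<exists>\<mu>>0. s = - \<mu> *\<^sub>R grad F x)) \<and>
    (F x + dual_barrier K F s + \<nu> = \<nu> * ln (grad F x (dual_grad (dual_barrier K F) s) / \<nu>)
      \<longleftrightarrow> (\<exists>\<mu>>0. s = - \<mu> *\<^sub>R grad F x))"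
proof -
  interpret proper_cone_barrier K F \<nu>
    using assms by unfold_locales
  note x = assms(4) and s = assms(5)
  obtain y where y: "y \<in> D" "grad F y = - s"
    using exists_grad_eq[OF x s] by blast
  have dual: "F x + dual_barrier K F s + \<nu> = F x - F y"
    using dual_barrier_eq[OF y] by simp
  have right: "grad F x (dual_grad (dual_barrier K F) s) = - grad F x y"
    using dual_grad_eq[OF y s] by (simp add: blinfun.minus_right)
  have sx: "0 < s x"
    by (rule dual_cone_interior_pos[OF s x])
  \<comment> \<open>Since \<open>s x = - grad F y x\<close>, the lower bound is the negated upper
    bound with \<open>x\<close> and \<open>y\<close> exchanged.\<close>
  then have left: "\<nu> * ln (\<nu> / s x) = - (\<nu> * ln (- grad F y x / \<nu>))"
    using nu_pos y(2) by (simp add: blinfun.minus_left ln_div right_diff_distrib)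
  have "\<exists>\<mu>'>0. w = \<mu>' *\<^sub>R v" if "\<exists>\<mu>>0. v = \<mu> *\<^sub>R w" for v w :: 'a
  proof -
    from that obtain \<mu> where "0 < \<mu>" "v = \<mu> *\<^sub>R w" by blast
    then show ?thesis by (intro exI[of _ "1 / \<mu>"]) auto
  qed
  then have sym: "(\<exists>\<mu>>0. x = \<mu> *\<^sub>R y) \<longleftrightarrow> (\<exists>\<mu>>0. y = \<mu> *\<^sub>R x)"
    by blast
  show ?thesis
    unfolding dual right left grad_proportional_iff[OF x y]
    using log_tangent(2,3)[OF x y(1)] log_tangent(2,3)[OF y(1) x] sym by auto
qed

end
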